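(* Let $E$ be a regular Hausdorff topological space and let $\underline{\phi},\overline{\phi}\colon B(E)\to[-\infty,\infty]$ be two monetary risk measures such that: (1) $\underline{\phi}(f)\le\overline{\phi}(f)$ for every $f\in B(E)$; (2) $\overline{\phi}$ is weakly maxitive; (3) $\underline{\phi}(f)\le\underline{\phi}(g_1)\vee\big(\bigvee_{i=2}^N\overline{\phi}(g_i)\big)$ for all $N\in\mathbb{N}$, $f\in U(E)$ and $g_1,\dots,g_N\in L(E)$ with $f\le\bigvee_{i=1}^N g_i$. Let $\underline{J}_A=\underline{\phi}(-\infty 1_{A^c})$ and $\overline{J}_A=\overline{\phi}(-\infty1_{A^c})$ for $A\in\mathcal{B}(E)$, and let $\underline{I},\overline{I}$ be the minimal rate functions associated with $\underline{J},\overline{J}$, respectively. Let $\mathcal{H}$ be a nonempty set of continuous real-valued functions on $E$, let $\overline{\phi}^\ast_{\mathcal{H}}(x)=\sup_{f\in\mathcal{H}}\{f(x)-\overline{\phi}(f)\}$, and let $\mathscr{E}$ be the set of all $\mathcal{H}$-exposed points of $\overline{\phi}^\ast_{\mathcal{H}}$ which admit an exposing function $f\in\mathcal{H}$ with $\overline{\phi}(f)=\underline{\phi}(f)$ and $f\in B_{\overline{\phi}}(E)$. Suppose that $\overline{J}$ is tight. Then: (i) For all $x\in\mathscr{E}$, $\underline{I}(x)=\overline{I}(x)=\overline{\phi}^\ast_{\mathcal{H}}(x)$. (ii) For every closed set $C\subset E$, $\overline{J}_C\le-\inf_{x\in C}\overline{\phi}^\ast_{\mathcal{H}}(x)$. (iii)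 For every open set $O\subset E$, $-\inf_{x\in O\cap\mathscr{E}}\overline{\phi}^\ast_{\mathcal{H}}(x)\le\underline{J}_O$. (iv) If, moreover, $\inf_{x\in O}\overline{\phi}^\ast_{\mathcal{H}}(x)=\inf_{x\in O\cap\mathscr{E}}\overline{\phi}^\ast_{\mathcal{H}}(x)$ for every open set $O\subset E$, then the pair $\underline{\phi},\overline{\phi}$ satisfies the large deviation principle and the Laplace principle with rate function $\overline{\phi}^\ast_{\mathcal{H}}$.
   Context: Notation and conventions. $\mathcal{B}(E)$ is the Borel $\sigma$-algebra; $B(E)$ is the set of all Borel measurable $f\colon E\to\mathbb{R}\cup\{-\infty\}$; $U(E)$ (resp. $L(E)$) is the set of all upper (resp. lower) semicontinuous functions $f\colon E\to\mathbb{R}\cup\{-\infty\}$; $C(E)=U(E)\cap L(E)$. The convention $-\infty\cdot0=0$ is used, so $f1_A-\infty1_{A^c}$ equals $f$ on $A$ and $-\infty$ on $A^c$. Also $\inf\emptyset=+\infty$; $\vee$ denotes maximum (pointwise for functions). Monetary risk measure: a function $\phi\colon B(E)\to[-\infty,\infty]$ with $\phi(0)=0$; $\phi(f)\le\phi(g)$ whenever $f\le g$; and $\phi(f+c)=\phi(f)+c$ for all $c\in\mathbb{R}$. It is weakly maxitive if $\phi(f)\le\bigvee_{i=1}^N\phi(g_i)$ for all $N\in\mathbb{N}$, $f\in U(E)$, $g_1,\dots,g_N\in L(E)$ with $f\le\bigvee_{i=1}^Ng_i$. For $\phi\colon B(E)\to[-\infty,\infty]$: $B_\phi(E)=\{f\in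 B(E):\exists\,t>1,\ \phi(tf)<\infty\}$ and $C_\phi(E)=\{f\in C(E):\exists\,t>1,\ \phi(tf)<\infty\}$. Concentration: a set function $J\colon\mathcal{B}(E)\to[-\infty,0]$ with $J_\emptyset=-\infty$, $J_E=0$, and $J_A\le J_B$ whenever $A\subset B$. (The set functions $\underline{J},\overline{J}$ of the claim are concentrations.) $J$ is tight if for every $n\in\mathbb{N}$ there is a compact $K\subset E$ with $J_{K^c}<-n$. The convex integral of $f\in B(E)$ with respect to $J$ is $\phi_J(f)=\sup_{c\in\mathbb{R}}\{c+J_{\{f>c\}}\}$. The minimal rate function associated with $J$ is $I_{\min}\colon E\to[0,\infty]$, $I_{\min}(x)=\sup_{f\in L(E)}\{f(x)-\phi_J(f)\}$, where terms with $f(x)=-\infty$ are understood to contribute $-\infty$. $\mathcal{H}$-exposed point: $x\in E$ is an $\mathcal{H}$-exposed point of $\overline{\phi}^\ast_{\mathcal{H}}$ if there is $f\in\mathcal{H}$ with $f(y)-\overline{\phi}^\ast_{\mathcal{H}}(y)<f(x)-\overline{\phi}^\ast_{\mathcal{H}}(x)$ for all $y\ne x$; such an $f$ is called an exposing function for $x$. Let $I\colon E\to[0,\infty]$ be a function (rate function). The pair $\underline{\phi},\overline{\phi}$ satisfies the large deviation principle with rate function $I$ if $-\inf_{x\in\mathrm{int}(A)}I(x)\le\underline{J}_A\le\overline{J}_A\le-\inf_{x\in\mathrm{cl}(A)}I(x)$ for all $A\in\mathcal{B}(E)$. It satisfies the Laplace principle with rate function $I$ if $\underline{\phi}(f)=\overline{\phi}(f)=\sup_{x\in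 E}\{f(x)-I(x)\}$ for all $f\in C_{\overline{\phi}}(E)$. *)

theory Defs
  imports "HOL-Analysis.Analysis"
begin

text \<open>
  Functions with values in the reals extended by \<open>-\<infinity>\<close> are modelled as \<open>ereal\<close>-valued functions
  that never take the value \<open>\<infinity>\<close>. A risk measure is a total function on \<open>'a \<Rightarrow> ereal\<close>, but only
  its values on \<open>B_fun\<close> are ever constrained or used.
\<close>

definition B_fun :: "('a::topological_space \<Rightarrow> ereal) set" where
  "B_fun = {f \<in> borel_measurable borel. \<forall>x. f x \<noteq> \<infinity>}"

definition U_fun :: "('a::topological_space \<Rightarrow> ereal) set" where
  "U_fun = {f. (\<forall>x. f x \<noteq> \<infinity>) \<and> (\<forall>c::real. open {x. f x < ereal c})}"

definition L_fun :: "('a::topological_space \<Rightarrow> ereal) set" where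
  "L_fun = {f. (\<forall>x. f x \<noteq> \<infinity>) \<and> (\<forall>c::real. open {x. ereal c < f x})}"

definition C_fun :: "('a::topological_space \<Rightarrow> ereal) set" where
  "C_fun = U_fun \<inter> L_fun"

definition monetary_risk_measure :: "(('a::topological_space \<Rightarrow> ereal) \<Rightarrow> ereal) \<Rightarrow> bool" where
  "monetary_risk_measure \<phi> \<longleftrightarrow>
     \<phi> (\<lambda>x. 0) = 0 \<and>
     (\<forall>f\<in>B_fun. \<forall>g\<in>B_fun. (\<forall>x. f x \<le> g x) \<longrightarrow> \<phi> f \<le> \<phi> g) \<and>
     (\<forall>f\<in>B_fun. \<forall>c::real. \<phi> (\<lambda>x. f x + ereal c) = \<phi> f + ereal c)"

definition weakly_maxitive :: "(('a::topological_space \<Rightarrow> ereal) \<Rightarrow> ereal) \<Rightarrow> bool" where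
  "weakly_maxitive \<phi> \<longleftrightarrow>
     (\<forall>N\<ge>1::nat. \<forall>f\<in>U_fun. \<forall>g. (\<forall>i\<in>{1..N}. g i \<in> L_fun) \<longrightarrow>
        (\<forall>x. f x \<le> (SUP i\<in>{1..N}. g i x)) \<longrightarrow> \<phi> f \<le> (SUP i\<in>{1..N}. \<phi> (g i)))"

definition B_of :: "(('a::topological_space \<Rightarrow> ereal) \<Rightarrow> ereal) \<Rightarrow> ('a \<Rightarrow> ereal) set" where
  "B_of \<phi> = {f \<in> B_fun. \<exists>t::real. t > 1 \<and> \<phi> (\<lambda>x. ereal t * f x) < \<infinity>}"

definition C_of :: "(('a::topological_space \<Rightarrow> ereal) \<Rightarrow> ereal) \<Rightarrow> ('a \<Rightarrow> ereal) set" where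
  "C_of \<phi> = {f \<in> C_fun. \<exists>t::real. t > 1 \<and> \<phi> (\<lambda>x. ereal t * f x) < \<infinity>}"

text \<open>In \<open>ereal\<close>, \<open>-\<infinity> * 0 = 0\<close>, so the argument of \<open>\<phi>\<close> below is 0 on \<open>A\<close> and \<open>-\<infinity>\<close> off \<open>A\<close>.\<close>

definition conc :: "(('a \<Rightarrow> ereal) \<Rightarrow> ereal) \<Rightarrow> 'a set \<Rightarrow> ereal" where
  "conc \<phi> A = \<phi> (\<lambda>x. -\<infinity> * indicator (- A) x)"

definition conc_tight :: "('a::topological_space set \<Rightarrow> ereal) \<Rightarrow> bool" where
  "conc_tight J \<longleftrightarrow> (\<forall>n::nat. \<exists>K. compact K \<and> J (- K) < - ereal (real n))"

definition convex_integral :: "('a set \<Rightarrow> ereal) \<Rightarrow> ('a \<Rightarrow> ereal) \<Rightarrow> ereal" where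
  "convex_integral J f = (SUP c::real. ereal c + J {x. ereal c < f x})"

text \<open>The case distinction is needed because \<open>-\<infinity> - (-\<infinity>) = \<infinity>\<close> in \<open>ereal\<close>.\<close>

definition I_min :: "('a::topological_space set \<Rightarrow> ereal) \<Rightarrow> 'a \<Rightarrow> ereal" where
  "I_min J x = (SUP f\<in>L_fun. if f x = -\<infinity> then -\<infinity> else f x - convex_integral J f)"

definition conj_on :: "('a \<Rightarrow> real) set \<Rightarrow> (('a \<Rightarrow> ereal) \<Rightarrow> ereal) \<Rightarrow> 'a \<Rightarrow> ereal" where
  "conj_on H \<phi> x = (SUP f\<in>H. ereal (f x) - \<phi> (\<lambda>y. ereal (f y)))"

definition exposing ::
    "('a \<Rightarrow> real) set \<Rightarrow> (('a \<Rightarrow> ereal) \<Rightarrow> ereal) \<Rightarrow> ('a \<Rightarrow> real) \<Rightarrow> 'a \<Rightarrow> bool" where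
  "exposing H \<phi> f x \<longleftrightarrow> f \<in> H \<and>
     (\<forall>y. y \<noteq> x \<longrightarrow> ereal (f y) - conj_on H \<phi> y < ereal (f x) - conj_on H \<phi> x)"

definition exposed_points ::
    "('a::topological_space \<Rightarrow> real) set \<Rightarrow> (('a \<Rightarrow> ereal) \<Rightarrow> ereal) \<Rightarrow>
     (('a \<Rightarrow> ereal) \<Rightarrow> ereal) \<Rightarrow> 'a set" where
  "exposed_points H \<phi>l \<phi>u =
     {x. \<exists>f. exposing H \<phi>u f x \<and> \<phi>u (\<lambda>y. ereal (f y)) = \<phi>l (\<lambda>y. ereal (f y)) \<and>
             (\<lambda>y. ereal (f y)) \<in> B_of \<phi>u}"

text \<open>The two principles are only meaningful for a rate function, i.e. a function with values in
  \<open>[0, \<infinity>]\<close>; nonnegativity is therefore part of both definitions.\<close>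

definition rate_function :: "('a \<Rightarrow> ereal) \<Rightarrow> bool" where
  "rate_function I \<longleftrightarrow> (\<forall>x. 0 \<le> I x)"

definition LDP ::
    "(('a::topological_space \<Rightarrow> ereal) \<Rightarrow> ereal) \<Rightarrow> (('a \<Rightarrow> ereal) \<Rightarrow> ereal) \<Rightarrow> ('a \<Rightarrow> ereal) \<Rightarrow> bool"
  where
  "LDP \<phi>l \<phi>u I \<longleftrightarrow> rate_function I \<and>
     (\<forall>A\<in>sets borel.
        - (INF x\<in>interior A. I x) \<le> conc \<phi>l A \<and> conc \<phi>l A \<le> conc \<phi>u A \<and>
        conc \<phi>u A \<le> - (INF x\<in>closure A. I x))"

definition laplace_principle ::
    "(('a::topological_space \<Rightarrow> ereal) \<Rightarrow> ereal) \<Rightarrow> (('a \<Rightarrow> ereal) \<Rightarrow> ereal) \<Rightarrow> ('a \<Rightarrow> ereal) \<Rightarrow> bool"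
  where
  "laplace_principle \<phi>l \<phi>u I \<longleftrightarrow> rate_function I \<and>
     (\<forall>f\<in>C_of \<phi>u. \<phi>l f = \<phi>u f \<and> \<phi>u f = (SUP x. f x - I x))"

end

theory Submission
  imports Defs
begin

text \<open>
  Everything follows from one compactness argument. Suppose that \<open>f - \<phi>\<^sup>*\<close> stays below a real
  number \<open>m\<close> on a closed set \<open>D\<close>, where \<open>\<phi>\<^sup>*\<close> is the conjugate of \<open>\<phi> = \<phi>u\<close> on \<open>H\<close>, \<open>f\<close> is
  continuous and \<open>\<phi> (t f) < \<infinity>\<close> for some \<open>t > 1\<close>. Then on \<open>D\<close> the function \<open>f\<close> lies below the
  maximum of finitely many lower semicontinuous functions, each of which has risk less than \<open>m\<close>
  (\<open>finite_majorant\<close>). Near a point \<open>y\<close> of \<open>D\<close> such a majorant is a constant just above \<open>f y\<close>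
  on a small neighbourhood and \<open>-\<infinity>\<close> elsewhere; its risk is small since some \<open>h\<close> in \<open>H\<close> with
  \<open>h y - \<phi> h\<close> close to \<open>\<phi>\<^sup>* y\<close> bounds the concentration of the neighbourhood. Compactness leaves
  finitely many neighbourhoods, tightness handles the complement of a compact set as long as \<open>f\<close>
  is bounded above there, and a translate of \<open>t f\<close> dominates \<open>f\<close> where \<open>f\<close> is large.

  Weak maxitivity turns such a majorant into an upper bound: with \<open>f = 0\<close> this is the bound for
  closed sets, with \<open>D\<close> the whole space it is the upper half of the Laplace principle.

  The lower bound uses the same majorant off an open neighbourhood \<open>U\<close> of an exposed point \<open>x\<close>,
  with \<open>f\<close> an exposing function and \<open>m = f x - \<phi>\<^sup>* x\<close>. Exposedness says precisely that
  \<open>f - \<phi>\<^sup>* < m\<close> off \<open>x\<close>, while \<open>m \<le> \<phi>u f = \<phi>l f\<close> by definition of the conjugate. So in the joint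
  maxitivity of \<open>\<phi>l\<close> and \<open>\<phi>u\<close> the maximum can only be attained at the piece living on \<open>U\<close>, which
  forces \<open>- \<phi>\<^sup>* x \<le> conc \<phi>l U\<close> (\<open>exposed_point_lower_bound\<close>).

  The remaining claims are soft. The minimal rate function of \<open>\<phi>u\<close> dominates \<open>\<phi>\<^sup>*\<close> because the convex
  integral is at most \<open>\<phi>u\<close>, and the local lower bound at \<open>x\<close> makes the minimal rate function of
  \<open>\<phi>l\<close> at most \<open>\<phi>\<^sup>* x\<close>. If infima of \<open>\<phi>\<^sup>*\<close> over open sets are determined by the exposed points,
  the local lower bound extends to all points, and both principles result.
\<close>

section \<open>Semicontinuous functions and cutoff-offs\<close>

lemma L_fun_subset_B_fun: "L_fun \<subseteq> B_fun"
proof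
  fix f :: "'a \<Rightarrow> ereal" assume f: "f \<in> L_fun"
  have level: "{x. ereal c < f x} \<in> sets borel" for c
    using f by (auto simp: L_fun_def)
  have "{x. a < f x} \<in> sets borel" for a
  proof (cases a)
    case (real r)
    then show ?thesis using level by simp
  next
    case PInf
    then show ?thesis by simp
  next
    case MInf
    have "{x. -\<infinity> < f x} = (\<Union>n::nat. {x. ereal (- real n) < f x})"
    proof (intro set_eqI iffI)
      fix x assume "x \<in> {x. -\<infinity> < f x}"
      then obtain r where "ereal r < f x" using ereal_dense2 by blast
      moreover obtain n where "- r < real n" using reals_Archimedean2 by blast
      ultimately have "ereal (- real n) < f x" by (cases "f x") auto
      then show "x \<in> (\<Union>n::nat. {x. ereal (- real n) < f x})" by blast
    next
      fix x assume "x \<in> (\<Union>n::nat. {x. ereal (- real n) < f x})"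
      then show "x \<in> {x. -\<infinity> < f x}" by (cases "f x") auto
    qed
    then show ?thesis using MInf level by auto
  qed
  then have "f \<in> borel_measurable borel"
    by (simp add: borel_measurable_ereal_iff_Ioi vimage_def greaterThan_def)
  then show "f \<in> B_fun" using f by (auto simp: L_fun_def B_fun_def)
qed

lemma scale_in_L_fun:
  assumes "f \<in> L_fun" "0 < t"
  shows "(\<lambda>x. ereal t * f x) \<in> L_fun"
proof -
  have "{x. ereal c < ereal t * f x} = {x. ereal (c / t) < f x}" for c
  proof -
    have "ereal c < ereal t * f x \<longleftrightarrow> ereal (c / t) < f x" for x
      using assms(2) by (cases "f x") (auto simp: field_simps)
    then show ?thesis by simp
  qed
  then show ?thesis using assms by (auto simp: L_fun_def)
qed

lemma C_fun_real:
  assumes "continuous_on UNIV h"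
  shows "(\<lambda>y. ereal (h y)) \<in> C_fun"
  using assms by (auto simp: C_fun_def U_fun_def L_fun_def intro!: open_Collect_less)

lemma zero_in_C_fun: "(\<lambda>_. 0) \<in> C_fun"
  using C_fun_real[of "\<lambda>_. 0"] by (simp add: zero_ereal_def)

text \<open>The constant \<^term>\<open>c\<close> on \<^term>\<open>A\<close> and \<open>-\<infinity>\<close> elsewhere: the building block of all
  majorants below, because a risk measure evaluates it as \<open>c\<close> plus its concentration on \<open>A\<close>.\<close>

definition cutoff :: "real \<Rightarrow> 'a set \<Rightarrow> 'a \<Rightarrow> ereal" where
  "cutoff c A x = (if x \<in> A then ereal c else -\<infinity>)"

lemma cutoff_in_L_fun: "open A \<Longrightarrow> cutoff c A \<in> L_fun"
proof -
  assume "open A"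
  moreover have "{x. ereal d < cutoff c A x} = (if d < c then A else {})" for d
    by (auto simp: cutoff_def)
  ultimately show ?thesis by (auto simp: L_fun_def cutoff_def)
qed

lemma cutoff_in_U_fun: "closed A \<Longrightarrow> cutoff c A \<in> U_fun"
proof -
  assume "closed A"
  moreover have "{x. cutoff c A x < ereal d} = (if c < d then UNIV else - A)" for d
    by (auto simp: cutoff_def)
  ultimately show ?thesis by (auto simp: U_fun_def cutoff_def)
qed

lemma cutoff_in_B_fun: "A \<in> sets borel \<Longrightarrow> cutoff c A \<in> B_fun"
  unfolding B_fun_def cutoff_def by auto

section \<open>Monetary risk measures and their concentrations\<close>

lemma monetary_mono:
  "\<lbrakk>monetary_risk_measure \<phi>; f \<in> B_fun; g \<in> B_fun; \<And>x. f x \<le> g x\<rbrakk> \<Longrightarrow> \<phi> f \<le> \<phi> g"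
  by (auto simp: monetary_risk_measure_def)

lemma monetary_zero: "monetary_risk_measure \<phi> \<Longrightarrow> \<phi> (\<lambda>x. 0) = 0"
  by (auto simp: monetary_risk_measure_def)

lemma monetary_shift:
  "\<lbrakk>monetary_risk_measure \<phi>; f \<in> B_fun\<rbrakk> \<Longrightarrow> \<phi> (\<lambda>x. f x + ereal c) = \<phi> f + ereal c"
  by (auto simp: monetary_risk_measure_def)

lemma conc_eq_cutoff: "conc \<phi> A = \<phi> (cutoff 0 A)"
proof -
  have "(\<lambda>x. -\<infinity> * indicator (- A) x) = cutoff 0 A"
    by (auto simp: cutoff_def indicator_def)
  then show ?thesis by (simp only: conc_def)
qed

lemma monetary_cutoff:
  assumes "monetary_risk_measure \<phi>" "A \<in> sets borel"
  shows "\<phi> (cutoff c A) = ereal c + conc \<phi> A"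
proof -
  have "cutoff c A = (\<lambda>x. cutoff 0 A x + ereal c)"
    by (auto simp: cutoff_def)
  then show ?thesis
    using monetary_shift[OF assms(1) cutoff_in_B_fun[OF assms(2), of 0], of c]
    by (simp add: conc_eq_cutoff add.commute)
qed

lemma conc_mono:
  assumes "monetary_risk_measure \<phi>" "A \<in> sets borel" "B \<in> sets borel" "A \<subseteq> B"
  shows "conc \<phi> A \<le> conc \<phi> B"
  unfolding conc_eq_cutoff
  using assms(4)
  by (intro monetary_mono[OF assms(1) cutoff_in_B_fun[OF assms(2)] cutoff_in_B_fun[OF assms(3)]])
    (auto simp: cutoff_def)

lemma le_monetary_superlevel:
  assumes "monetary_risk_measure \<phi>" "f \<in> L_fun"
  shows "ereal c + conc \<phi> {x. ereal c < f x} \<le> \<phi> f"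
proof -
  have op: "open {x. ereal c < f x}" using assms(2) by (auto simp: L_fun_def)
  have "\<phi> (cutoff c {x. ereal c < f x}) \<le> \<phi> f"
    by (rule monetary_mono[OF assms(1)])
      (use assms(2) L_fun_subset_B_fun cutoff_in_L_fun[OF op] in \<open>auto simp: cutoff_def\<close>)
  then show ?thesis using monetary_cutoff[OF assms(1)] op by auto
qed

lemma convex_integral_le:
  "\<lbrakk>monetary_risk_measure \<phi>; f \<in> L_fun\<rbrakk> \<Longrightarrow> convex_integral (conc \<phi>) f \<le> \<phi> f"
  unfolding convex_integral_def by (intro SUP_least le_monetary_superlevel)

lemma convex_integral_zero_le:
  assumes "monetary_risk_measure \<phi>"
  shows "convex_integral (conc \<phi>) (\<lambda>x. 0) \<le> 0"
  using convex_integral_le[OF assms zero_in_C_fun[unfolded C_fun_def, THEN IntD2]]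
  by (simp add: monetary_zero[OF assms])

section \<open>Maxitivity for finite families\<close>

text \<open>The maximum over a finite family is attained, so that maxitivity singles out one member; this
  form also avoids numbering the majorants.\<close>

lemma weakly_maxitive_finite:
  assumes "weakly_maxitive \<phi>" "f \<in> U_fun" "finite G" "G \<subseteq> L_fun" "\<And>x. \<exists>g\<in>G. f x \<le> g x"
  shows "\<exists>g\<in>G. \<phi> f \<le> \<phi> g"
proof -
  have "G \<noteq> {}" using assms(5) by auto
  obtain e where e: "bij_betw e {1..card G} G"
    using ex_bij_betw_nat_finite_1[OF assms(3)] by blast
  have im: "e ` {1..card G} = G" using e by (simp add: bij_betw_def)
  have N: "card G \<ge> 1" using \<open>G \<noteq> {}\<close> assms(3) by (simp add: Suc_le_eq card_gt_0_iff)
  have "f x \<le> (SUP i\<in>{1..card G}. e i x)" for x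
  proof -
    obtain g where "g \<in> G" "f x \<le> g x" using assms(5) by blast
    moreover obtain i where "i \<in> {1..card G}" "g = e i" using im \<open>g \<in> G\<close> by blast
    ultimately show ?thesis by (auto intro: SUP_upper2)
  qed
  moreover have "\<forall>i\<in>{1..card G}. e i \<in> L_fun" using im assms(4) by auto
  ultimately have "\<phi> f \<le> (SUP i\<in>{1..card G}. \<phi> (e i))"
    using assms(1,2) N unfolding weakly_maxitive_def by blast
  also have "\<dots> = (SUP g\<in>G. \<phi> g)" using im by (metis image_image)
  also have "\<dots> = Max (\<phi> ` G)" using assms(3) \<open>G \<noteq> {}\<close> by (simp add: Max_Sup)
  finally have "\<phi> f \<le> Max (\<phi> ` G)" .
  then show ?thesis using assms(3) \<open>G \<noteq> {}\<close> by (simp add: Max_ge_iff)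
qed

lemma relative_maxitivity_finite:
  fixes \<phi>l \<phi>u :: "('a::topological_space \<Rightarrow> ereal) \<Rightarrow> ereal"
  assumes maxi: "\<And>(N::nat) f g. \<lbrakk>N \<ge> 1; f \<in> U_fun; \<And>i. i \<in> {1..N} \<Longrightarrow> g i \<in> L_fun;
           \<And>x. f x \<le> (SUP i\<in>{1..N}. g i x)\<rbrakk>
         \<Longrightarrow> \<phi>l f \<le> max (\<phi>l (g 1)) (SUP i\<in>{2..N}. \<phi>u (g i))"
    and "f \<in> U_fun" "g\<^sub>1 \<in> L_fun" "finite G" "G \<noteq> {}" "G \<subseteq> L_fun"
    and cover: "\<And>x. f x \<le> g\<^sub>1 x \<or> (\<exists>g\<in>G. f x \<le> g x)"
  shows "\<phi>l f \<le> \<phi>l g\<^sub>1 \<or> (\<exists>g\<in>G. \<phi>l f \<le> \<phi>u g)"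
proof -
  obtain e where e: "bij_betw e {1..card G} G"
    using ex_bij_betw_nat_finite_1[OF assms(4)] by blast
  have im: "e ` {1..card G} = G" using e by (simp add: bij_betw_def)
  \<comment> \<open>Index \<open>1\<close> is reserved for the function that \<open>\<phi>l\<close> evaluates; the members of \<open>G\<close> move up by one.\<close>
  define k where "k i = (if i = 1 then g\<^sub>1 else e (i - 1))" for i :: nat
  have im2: "k ` {2..Suc (card G)} = G"
  proof -
    have "{2..Suc (card G)} = Suc ` {1..card G}"
      by (simp add: numeral_2_eq_2)
    then have "k ` {2..Suc (card G)} = (\<lambda>i. k (Suc i)) ` {1..card G}"
      by (simp only: image_image)
    also have "\<dots> = e ` {1..card G}"
      by (intro image_cong) (auto simp: k_def)
    finally have "k ` {2..Suc (card G)} = e ` {1..card G}" .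
    then show ?thesis using im by simp
  qed
  have split: "{1..Suc (card G)} = insert 1 {2..Suc (card G)}" by auto
  have "\<phi>l f \<le> max (\<phi>l (k 1)) (SUP i\<in>{2..Suc (card G)}. \<phi>u (k i))"
  proof (rule maxi)
    show "k i \<in> L_fun" if "i \<in> {1..Suc (card G)}" for i
      using that im2 assms(3,6) unfolding split by (auto simp: k_def)
    show "f x \<le> (SUP i\<in>{1..Suc (card G)}. k i x)" for x
    proof -
      obtain i where "i \<in> {1..Suc (card G)}" "f x \<le> k i x"
      proof (cases "f x \<le> g\<^sub>1 x")
        case True
        then show thesis using that[of 1] by (simp add: k_def)
      next
        case False
        then obtain g where "g \<in> G" "f x \<le> g x" using cover by blast
        moreover obtain i where "i \<in> {2..Suc (card G)}" "g = k i" using im2 \<open>g \<in> G\<close> by blast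
        ultimately show thesis using that[of i] by auto
      qed
      then show ?thesis by (auto intro: SUP_upper2)
    qed
  qed (use assms in auto)
  also have "(SUP i\<in>{2..Suc (card G)}. \<phi>u (k i)) = (SUP g\<in>G. \<phi>u g)"
    using im2 by (metis image_image)
  also have "\<dots> = Max (\<phi>u ` G)" using assms(4,5) by (simp add: Max_Sup)
  finally have "\<phi>l f \<le> \<phi>l g\<^sub>1 \<or> \<phi>l f \<le> Max (\<phi>u ` G)"
    by (simp add: le_max_iff_disj k_def)
  then show ?thesis using assms(4,5) by (simp add: Max_ge_iff)
qed

section \<open>Finite majorants and the upper bounds\<close>

text \<open>If \<open>h\<close> nearly attains the supremum at \<open>y\<close>, then on a neighbourhood of \<open>y\<close> it exceeds a
  constant that is only slightly below \<open>h y\<close>, and monotonicity bounds the concentration there.\<close>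

lemma conj_on_local_bound:
  fixes \<phi> :: "('a::topological_space \<Rightarrow> ereal) \<Rightarrow> ereal"
  assumes "monetary_risk_measure \<phi>" "\<And>h. h \<in> H \<Longrightarrow> continuous_on UNIV h"
    and "ereal a < conj_on H \<phi> y"
  obtains V where "open V" "y \<in> V" "conc \<phi> V \<le> - ereal a"
proof -
  obtain h where h: "h \<in> H" "ereal a < ereal (h y) - \<phi> (\<lambda>z. ereal (h z))"
    using assms(3) unfolding conj_on_def less_SUP_iff by blast
  have "\<phi> (\<lambda>z. ereal (h z)) < ereal (h y - a)"
    using h(2) by (cases "\<phi> (\<lambda>z. ereal (h z))") auto
  then obtain q where q: "\<phi> (\<lambda>z. ereal (h z)) < ereal q" "q < h y - a"
    using ereal_dense2 by (metis less_ereal.simps(1))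
  define V where "V = {z. ereal (q + a) < ereal (h z)}"
  have C: "(\<lambda>z. ereal (h z)) \<in> L_fun"
    using C_fun_real[OF assms(2)[OF h(1)]] by (simp add: C_fun_def)
  have "open V" using C unfolding V_def L_fun_def by blast
  moreover have "y \<in> V" using q(2) by (simp add: V_def)
  moreover have "ereal (q + a) + conc \<phi> V < ereal q"
    using le_monetary_superlevel[OF assms(1) C, of "q + a"] q(1) unfolding V_def
    by (rule le_less_trans)
  then have "conc \<phi> V \<le> - ereal a" by (cases "conc \<phi> V") auto
  ultimately show thesis using that by blast
qed

text \<open>The majorants are of three kinds: cut-offs on small open sets, finitely many of which cover the
  part of \<open>D\<close> inside a compact set \<open>K\<close>; the constant \<open>b\<close> on the complement of \<open>K\<close>; and
  \<open>t f - (t - 1) b\<close>, which dominates \<open>f\<close> wherever \<open>f\<close> exceeds \<open>b\<close>. The level \<open>b\<close> is fixed first,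
  large enough for the third function, and \<open>K\<close> is then chosen according to \<open>b\<close>.\<close>

lemma finite_majorant:
  fixes \<phi> :: "('a::t2_space \<Rightarrow> ereal) \<Rightarrow> ereal"
  assumes mon: "monetary_risk_measure \<phi>" and tight: "conc_tight (conc \<phi>)"
    and H: "\<And>h. h \<in> H \<Longrightarrow> continuous_on UNIV h"
    and f: "f \<in> C_of \<phi>" and D: "closed D"
    and less: "\<And>y. y \<in> D \<Longrightarrow> f y - conj_on H \<phi> y < ereal m"
  obtains G where "finite G" "G \<noteq> {}" "G \<subseteq> L_fun" "\<And>g. g \<in> G \<Longrightarrow> \<phi> g < ereal m"
    "\<And>y. y \<in> D \<Longrightarrow> \<exists>g\<in>G. f y \<le> g y"
proof -
  obtain t where fU: "f \<in> U_fun" and fL: "f \<in> L_fun" and t: "t > 1"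
    and tf: "\<phi> (\<lambda>x. ereal t * f x) < \<infinity>"
    using f by (auto simp: C_of_def C_fun_def)
  have tL: "(\<lambda>x. ereal t * f x) \<in> L_fun"
    using scale_in_L_fun[OF fL] t by simp
  obtain b where b: "\<phi> (\<lambda>x. ereal t * f x) + ereal (- ((t - 1) * b)) < ereal m"
  proof (cases "\<phi> (\<lambda>x. ereal t * f x)")
    case (real r)
    then show thesis using that[of "(r - m + 1) / (t - 1)"] t by simp
  qed (use tf that[of 0] in auto)
  define tail where "tail = (\<lambda>x. ereal t * f x + ereal (- ((t - 1) * b)))"
  have tail_L: "tail \<in> L_fun"
  proof -
    have "ereal c < tail x \<longleftrightarrow> ereal (c + (t - 1) * b) < ereal t * f x" for c x
      unfolding tail_def using t by (cases "f x") (auto simp: algebra_simps)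
    then show ?thesis using tL by (auto simp: L_fun_def tail_def)
  qed
  have tail_m: "\<phi> tail < ereal m"
    using monetary_shift[OF mon, of "\<lambda>x. ereal t * f x" "- ((t - 1) * b)"] tL L_fun_subset_B_fun b
    unfolding tail_def by auto
  have tail_f: "f x \<le> tail x" if "ereal b < f x" for x
  proof (cases "f x")
    case (real r)
    then have "(t - 1) * b \<le> (t - 1) * r" using that t by simp
    then show ?thesis using real by (simp add: tail_def algebra_simps)
  qed (use that fL in \<open>auto simp: L_fun_def\<close>)
  obtain n :: nat where n: "b - m < real n" using reals_Archimedean2 by blast
  obtain K where K: "compact K" "conc \<phi> (- K) < - ereal (real n)"
    using tight unfolding conc_tight_def by blast
  have Kop: "open (- K)" using K(1) compact_imp_closed by auto
  have far_m: "\<phi> (cutoff b (- K)) < ereal m"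
    unfolding monetary_cutoff[OF mon borel_open[OF Kop]] using K(2) n
    by (cases "conc \<phi> (- K)") auto
  have "\<exists>s V. open V \<and> y \<in> V \<and> (\<forall>z\<in>V. f z < ereal s) \<and> \<phi> (cutoff s V) < ereal m"
    if y: "y \<in> D" for y
  proof -
    \<comment> \<open>The strict inequality at \<open>y\<close> leaves room for real bounds on both terms; either may be infinite.\<close>
    obtain a s where as: "ereal a < conj_on H \<phi> y" "f y < ereal s" "s - a < m"
    proof (cases "f y")
      case (real r)
      have "ereal (r - m) < conj_on H \<phi> y"
        using less[OF y] real by (cases "conj_on H \<phi> y") auto
      then obtain a where "r - m < a" "ereal a < conj_on H \<phi> y"
        using ereal_dense2 by (metis less_ereal.simps(1))
      then show thesis using that[of a "(r + m + a) / 2"] real by (simp add: field_simps)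
    next
      case MInf
      then have "-\<infinity> < conj_on H \<phi> y" using less[OF y] by (cases "conj_on H \<phi> y") auto
      then obtain a where "ereal a < conj_on H \<phi> y" using ereal_dense2 by blast
      then show thesis using that[of a "m + a - 1"] MInf by simp
    qed (use fL in \<open>auto simp: L_fun_def\<close>)
    obtain V where V: "open V" "y \<in> V" "conc \<phi> V \<le> - ereal a"
      using conj_on_local_bound[OF mon H as(1)] by blast
    define W where "W = V \<inter> {z. f z < ereal s}"
    have W: "open W" using V(1) fU by (auto simp: W_def U_fun_def)
    have "conc \<phi> W \<le> - ereal a"
      using conc_mono[OF mon borel_open[OF W] borel_open[OF V(1)]] V(3) by (auto simp: W_def)
    then have "\<phi> (cutoff s W) < ereal m"
      unfolding monetary_cutoff[OF mon borel_open[OF W]] using as(3) by (cases "conc \<phi> W") auto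
    then show ?thesis using W V(2) as(2) by (intro exI[of _ s] exI[of _ W]) (auto simp: W_def)
  qed
  then obtain s V where V: "\<And>y. y \<in> D \<Longrightarrow> open (V y)" "\<And>y. y \<in> D \<Longrightarrow> y \<in> V y"
    "\<And>y z. y \<in> D \<Longrightarrow> z \<in> V y \<Longrightarrow> f z < ereal (s y)"
    "\<And>y. y \<in> D \<Longrightarrow> \<phi> (cutoff (s y) (V y)) < ereal m"
    by metis
  have "compact (K \<inter> D)" using K(1) D by (rule compact_Int_closed)
  then obtain Y where Y: "Y \<subseteq> K \<inter> D" "finite Y" "K \<inter> D \<subseteq> (\<Union>y\<in>Y. V y)"
    by (rule compactE_image[of _ "K \<inter> D" V]) (use V in auto)
  show thesis
  proof
    let ?G = "insert tail (insert (cutoff b (- K)) ((\<lambda>y. cutoff (s y) (V y)) ` Y))"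
    show "finite ?G" "?G \<noteq> {}" using Y by auto
    show "?G \<subseteq> L_fun" using tail_L Kop V(1) Y(1) by (auto intro!: cutoff_in_L_fun)
    show "\<phi> g < ereal m" if "g \<in> ?G" for g using that tail_m far_m V(4) Y(1) by auto
    show "\<exists>g\<in>?G. f y \<le> g y" if "y \<in> D" for y
    proof (cases "y \<in> K")
      case True
      then obtain z where "z \<in> Y" "y \<in> V z" using Y(3) \<open>y \<in> D\<close> by blast
      then have "f y \<le> cutoff (s z) (V z) y" using V(3)[of z y] Y(1) by (auto simp: cutoff_def)
      then show ?thesis using \<open>z \<in> Y\<close> by auto
    next
      case False
      then have "f y \<le> tail y \<or> f y \<le> cutoff b (- K) y"
        using tail_f[of y] by (auto simp: cutoff_def not_le)
      then show ?thesis by auto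
    qed
  qed
qed

text \<open>The majorant of \<open>0\<close> on \<open>C\<close> also dominates the cut-off of \<open>0\<close> to \<open>C\<close>, whose risk is the
  concentration of \<open>C\<close>.\<close>

lemma closed_upper_bound:
  fixes \<phi> :: "('a::t2_space \<Rightarrow> ereal) \<Rightarrow> ereal"
  assumes "monetary_risk_measure \<phi>" "weakly_maxitive \<phi>" "conc_tight (conc \<phi>)"
    and "\<And>h. h \<in> H \<Longrightarrow> continuous_on UNIV h" and "closed C"
  shows "conc \<phi> C \<le> - (INF x\<in>C. conj_on H \<phi> x)"
proof (rule ereal_le_real)
  fix m assume m: "- (INF x\<in>C. conj_on H \<phi> x) \<le> ereal m"
  have "conc \<phi> C \<le> ereal m'" if "m < m'" for m'
  proof -
    have "0 - conj_on H \<phi> y < ereal m'" if y: "y \<in> C" for y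
    proof -
      have "- conj_on H \<phi> y \<le> - (INF x\<in>C. conj_on H \<phi> x)" using y by (simp add: INF_lower)
      also have "\<dots> \<le> ereal m" by (rule m)
      also have "\<dots> < ereal m'" using \<open>m < m'\<close> by simp
      finally show ?thesis by (simp add: minus_ereal_def)
    qed
    moreover have "(\<lambda>_. 0) \<in> C_of \<phi>"
      using zero_in_C_fun monetary_zero[OF assms(1)]
      by (auto simp: C_of_def intro!: exI[of _ 2])
    ultimately obtain G where G: "finite G" "G \<noteq> {}" "G \<subseteq> L_fun"
      "\<And>g. g \<in> G \<Longrightarrow> \<phi> g < ereal m'" "\<And>y. y \<in> C \<Longrightarrow> \<exists>g\<in>G. 0 \<le> g y"
      using finite_majorant[OF assms(1,3,4) _ assms(5), where f = "\<lambda>_. 0" and m = m' and H = H]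
      by metis
    have "\<exists>g\<in>G. cutoff 0 C x \<le> g x" for x
      using G(2) G(5)[of x] by (cases "x \<in> C") (auto simp: cutoff_def zero_ereal_def)
    then obtain g where "g \<in> G" "conc \<phi> C \<le> \<phi> g"
      using weakly_maxitive_finite[OF assms(2) cutoff_in_U_fun[OF assms(5)] G(1,3)]
      unfolding conc_eq_cutoff by blast
    then show ?thesis using G(4)[of g] by auto
  qed
  then show "conc \<phi> C \<le> ereal m"
    by (metis ereal_dense2 less_ereal.simps(1) not_le)
qed

lemma laplace_upper_bound:
  fixes \<phi> :: "('a::t2_space \<Rightarrow> ereal) \<Rightarrow> ereal"
  assumes "monetary_risk_measure \<phi>" "weakly_maxitive \<phi>" "conc_tight (conc \<phi>)"
    and "\<And>h. h \<in> H \<Longrightarrow> continuous_on UNIV h" and f: "f \<in> C_of \<phi>"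
  shows "\<phi> f \<le> (SUP x. f x - conj_on H \<phi> x)"
proof (rule dense_ge)
  fix m' assume "(SUP x. f x - conj_on H \<phi> x) < m'"
  then obtain m where m: "(SUP x. f x - conj_on H \<phi> x) < ereal m" "ereal m < m'"
    using ereal_dense2 by blast
  have "f y - conj_on H \<phi> y < ereal m" for y
    using m(1) by (meson SUP_lessD UNIV_I)
  then obtain G where G: "finite G" "G \<subseteq> L_fun" "\<And>g. g \<in> G \<Longrightarrow> \<phi> g < ereal m"
    "\<And>y. \<exists>g\<in>G. f y \<le> g y"
    using finite_majorant[OF assms(1,3,4,5) closed_UNIV, where m = m and H = H]
    by (metis UNIV_I)
  have "f \<in> U_fun" using f by (auto simp: C_of_def C_fun_def)
  then show "\<phi> f \<le> m'"
    using weakly_maxitive_finite[OF assms(2) _ G(1,2,4)] G(3) m(2)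
    by (meson le_less_trans less_imp_le less_trans)
qed

text \<open>Where \<open>f\<close> is positive it is at most \<open>t f\<close>, so \<open>f\<close> lies below the maximum of \<open>t f\<close> and \<open>0\<close>.\<close>

lemma C_of_finite:
  assumes "monetary_risk_measure \<phi>" "weakly_maxitive \<phi>" "f \<in> C_of \<phi>"
  shows "\<phi> f < \<infinity>"
proof -
  obtain t where f: "f \<in> U_fun" "f \<in> L_fun" and t: "t > 1" "\<phi> (\<lambda>x. ereal t * f x) < \<infinity>"
    using assms(3) by (auto simp: C_of_def C_fun_def)
  let ?G = "{\<lambda>x. ereal t * f x, \<lambda>x. 0}"
  have "?G \<subseteq> L_fun"
    using scale_in_L_fun[OF f(2)] t(1) zero_in_C_fun by (auto simp: C_fun_def)
  moreover have "f x \<le> ereal t * f x \<or> f x \<le> 0" for x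
    using t(1) by (cases "f x") auto
  ultimately have "\<exists>g\<in>?G. \<phi> f \<le> \<phi> g"
    by (intro weakly_maxitive_finite[OF assms(2) f(1)]) auto
  then show ?thesis using t(2) monetary_zero[OF assms(1)] by auto
qed

section \<open>The lower bound at exposed points\<close>

text \<open>All majorants of \<open>f\<close> off the neighbourhood \<open>U\<close> have risk strictly below
  \<open>m = f x - conj_on H \<phi>u x\<close>, so they cannot account for \<open>\<phi>l f \<ge> m\<close>. The piece on \<open>U\<close>, where \<open>f\<close>
  is less than \<open>f x + e\<close>, must do so. The agreement of \<open>\<phi>l\<close> and \<open>\<phi>u\<close> at the exposing function enters
  only through \<open>\<phi>l f \<ge> m\<close>.\<close>

lemma exposed_point_lower_bound:
  fixes \<phi>l \<phi>u :: "('a::t2_space \<Rightarrow> ereal) \<Rightarrow> ereal"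
  assumes mon: "monetary_risk_measure \<phi>l" "monetary_risk_measure \<phi>u"
    and wm: "weakly_maxitive \<phi>u"
    and maxi: "\<And>(N::nat) f g. \<lbrakk>N \<ge> 1; f \<in> U_fun; \<And>i. i \<in> {1..N} \<Longrightarrow> g i \<in> L_fun;
           \<And>x. f x \<le> (SUP i\<in>{1..N}. g i x)\<rbrakk>
         \<Longrightarrow> \<phi>l f \<le> max (\<phi>l (g 1)) (SUP i\<in>{2..N}. \<phi>u (g i))"
    and H: "\<And>f. f \<in> H \<Longrightarrow> continuous_on UNIV f"
    and tight: "conc_tight (conc \<phi>u)"
    and x: "x \<in> exposed_points H \<phi>l \<phi>u" and S: "open S" "x \<in> S"
  shows "- conj_on H \<phi>u x \<le> conc \<phi>l S"
proof -
  obtain f where f: "f \<in> H"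
    and expo: "\<And>y. y \<noteq> x \<Longrightarrow> ereal (f y) - conj_on H \<phi>u y < ereal (f x) - conj_on H \<phi>u x"
    and eq: "\<phi>u (\<lambda>y. ereal (f y)) = \<phi>l (\<lambda>y. ereal (f y))"
    and Bf: "(\<lambda>y. ereal (f y)) \<in> B_of \<phi>u"
    using x by (auto simp: exposed_points_def exposing_def)
  let ?f = "\<lambda>y. ereal (f y)"
  have fC: "?f \<in> C_fun" using C_fun_real[OF H[OF f]] .
  then have fCof: "?f \<in> C_of \<phi>u" using Bf by (auto simp: C_of_def B_of_def)
  have fin: "\<phi>u ?f < \<infinity>" using C_of_finite[OF mon(2) wm fCof] .
  have conj_ge: "ereal (f x) - \<phi>u ?f \<le> conj_on H \<phi>u x"
    unfolding conj_on_def using f by (rule SUP_upper)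
  show ?thesis
  proof (cases "conj_on H \<phi>u x")
    case PInf
    then show ?thesis by simp
  next
    case MInf
    then show ?thesis using conj_ge fin by (cases "\<phi>u ?f") auto
  next
    case (real r)
    define m where "m = f x - r"
    have m_le: "ereal m \<le> \<phi>l ?f"
      using conj_ge real unfolding eq m_def by (cases "\<phi>l ?f") auto
    have "- ereal r \<le> conc \<phi>l S + ereal e" if e: "0 < e" for e
    proof -
      define U where "U = S \<inter> {y. ereal (f y) < ereal (f x + e)}"
      have "open {y. ereal (f y) < ereal (f x + e)}"
        using fC unfolding C_fun_def U_fun_def by blast
      then have U: "open U" using S(1) by (auto simp: U_def)
      have "ereal (f y) - conj_on H \<phi>u y < ereal m" if "y \<in> - U" for y
      proof -
        have "y \<noteq> x" using that S(2) e by (auto simp: U_def)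
        then show ?thesis using expo[of y] real by (simp add: m_def)
      qed
      then obtain G where G: "finite G" "G \<noteq> {}" "G \<subseteq> L_fun"
        "\<And>g. g \<in> G \<Longrightarrow> \<phi>u g < ereal m" "\<And>y. y \<in> - U \<Longrightarrow> \<exists>g\<in>G. ereal (f y) \<le> g y"
        using finite_majorant[OF mon(2) tight H fCof, of H "- U" m] U
        by (metis closed_Compl)
      have "\<phi>l ?f \<le> \<phi>l (cutoff (f x + e) U) \<or> (\<exists>g\<in>G. \<phi>l ?f \<le> \<phi>u g)"
      proof (rule relative_maxitivity_finite[OF maxi _ cutoff_in_L_fun[OF U] G(1-3)])
        show "?f \<in> U_fun" using fC by (simp add: C_fun_def)
        show "ereal (f y) \<le> cutoff (f x + e) U y \<or> (\<exists>g\<in>G. ereal (f y) \<le> g y)" for y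
          using G(5)[of y] by (cases "y \<in> U") (auto simp: U_def cutoff_def)
      qed
      then have "\<phi>l ?f \<le> \<phi>l (cutoff (f x + e) U)"
        using G(4) m_le by (meson leD le_less_trans order_trans)
      then have "ereal m \<le> ereal (f x + e) + conc \<phi>l U"
        using m_le monetary_cutoff[OF mon(1) borel_open[OF U], of "f x + e"] by simp
      moreover have "conc \<phi>l U \<le> conc \<phi>l S"
        using conc_mono[OF mon(1) borel_open[OF U] borel_open[OF S(1)]] by (auto simp: U_def)
      ultimately show ?thesis
        unfolding m_def by (cases "conc \<phi>l U"; cases "conc \<phi>l S") auto
    qed
    then show ?thesis using real by (simp add: ereal_le_epsilon2)
  qed
qed

section \<open>Rate functions\<close>

lemma I_min_nonneg:
  assumes "monetary_risk_measure \<phi>"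
  shows "0 \<le> I_min (conc \<phi>) x"
proof -
  have "(\<lambda>_. 0) \<in> L_fun" using zero_in_C_fun by (auto simp: C_fun_def)
  then have "0 - convex_integral (conc \<phi>) (\<lambda>_. 0) \<le> I_min (conc \<phi>) x"
    unfolding I_min_def by (intro SUP_upper2[of "\<lambda>_. 0"]) auto
  moreover have "0 \<le> 0 - convex_integral (conc \<phi>) (\<lambda>_. 0)"
    using convex_integral_zero_le[OF assms] by (simp add: ereal_uminus_le_reorder minus_ereal_def)
  ultimately show ?thesis by (rule order_trans[rotated])
qed

lemma I_min_antimono:
  fixes J J' :: "'a::topological_space set \<Rightarrow> ereal"
  assumes "\<And>A. A \<in> sets borel \<Longrightarrow> J A \<le> J' A"
  shows "I_min J' x \<le> I_min J x"
  unfolding I_min_def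
proof (rule SUP_subset_mono[OF subset_refl])
  show "(if f x = -\<infinity> then -\<infinity> else f x - convex_integral J' f)
    \<le> (if f x = -\<infinity> then -\<infinity> else f x - convex_integral J f)" if "f \<in> L_fun" for f
  proof -
    have "open {y. ereal c < f y}" for c using that by (auto simp: L_fun_def)
    then have "convex_integral J f \<le> convex_integral J' f"
      unfolding convex_integral_def by (intro SUP_mono' add_left_mono assms borel_open)
    then show ?thesis by (auto intro: ereal_minus_mono)
  qed
qed

lemma conj_on_le_I_min:
  fixes \<phi> :: "('a::topological_space \<Rightarrow> ereal) \<Rightarrow> ereal"
  assumes "monetary_risk_measure \<phi>" "\<And>h. h \<in> H \<Longrightarrow> continuous_on UNIV h"
  shows "conj_on H \<phi> x \<le> I_min (conc \<phi>) x"
  unfolding conj_on_def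
proof (rule SUP_least)
  fix h assume "h \<in> H"
  then have L: "(\<lambda>y. ereal (h y)) \<in> L_fun" using C_fun_real assms(2) by (auto simp: C_fun_def)
  have "ereal (h x) - \<phi> (\<lambda>y. ereal (h y))
      \<le> ereal (h x) - convex_integral (conc \<phi>) (\<lambda>y. ereal (h y))"
    by (intro ereal_minus_mono convex_integral_le[OF assms(1) L]) auto
  also have "\<dots> \<le> I_min (conc \<phi>) x"
    unfolding I_min_def by (rule SUP_upper2[OF L]) auto
  finally show "ereal (h x) - \<phi> (\<lambda>y. ereal (h y)) \<le> I_min (conc \<phi>) x" .
qed

text \<open>By lower semicontinuity every level set \<open>{y. c < f y}\<close> with \<open>c < f x\<close> is an open neighbourhood
  of \<open>x\<close>. A lower bound on the neighbourhoods of a single point therefore bounds every convex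
  integral from below; both \<open>I_min_le\<close> and \<open>laplace_lower_bound\<close> rest on this.\<close>

lemma le_convex_integral:
  assumes "f \<in> L_fun" "f x \<noteq> -\<infinity>" and J: "\<And>S. open S \<Longrightarrow> x \<in> S \<Longrightarrow> - i \<le> J S"
  shows "f x - i \<le> convex_integral J f"
proof -
  have level: "ereal c - i \<le> convex_integral J f" if "ereal c < f x" for c
  proof -
    have "open {y. ereal c < f y}" using assms(1) by (auto simp: L_fun_def)
    then have "- i \<le> J {y. ereal c < f y}" using J that by simp
    then have "ereal c - i \<le> ereal c + J {y. ereal c < f y}"
      by (simp add: minus_ereal_def add_left_mono)
    also have "\<dots> \<le> convex_integral J f"
      unfolding convex_integral_def by (rule SUP_upper) simp
    finally show ?thesis .
  qed
  obtain r where r: "f x = ereal r"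
    using assms(1,2) by (cases "f x") (auto simp: L_fun_def)
  have "ereal r - i \<le> convex_integral J f + ereal e" if "0 < e" for e
    using level[of "r - e"] r that by (cases i; cases "convex_integral J f") auto
  then show ?thesis unfolding r by (simp add: ereal_le_epsilon2)
qed

lemma I_min_le:
  assumes J: "\<And>S. open S \<Longrightarrow> x \<in> S \<Longrightarrow> - i \<le> J S"
  shows "I_min J x \<le> i"
  unfolding I_min_def
proof (rule SUP_least)
  fix f :: "'a \<Rightarrow> ereal" assume f: "f \<in> L_fun"
  have "f x - i \<le> convex_integral J f" if "f x \<noteq> -\<infinity>"
    using le_convex_integral[OF f that] J by blast
  then show "(if f x = -\<infinity> then -\<infinity> else f x - convex_integral J f) \<le> i"
    using f
    by (cases "f x"; cases i; cases "convex_integral J f") (auto simp: L_fun_def)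
qed

lemma laplace_lower_bound:
  assumes "monetary_risk_measure \<phi>" "f \<in> L_fun" "\<And>x. 0 \<le> I x"
    and J: "\<And>S x. open S \<Longrightarrow> x \<in> S \<Longrightarrow> - I x \<le> conc \<phi> S"
  shows "(SUP x. f x - I x) \<le> \<phi> f"
proof (rule SUP_least)
  fix x
  show "f x - I x \<le> \<phi> f"
  proof (cases "f x = -\<infinity>")
    case True
    then show ?thesis using assms(3)[of x] by (cases "I x") auto
  next
    case False
    then show ?thesis
      using le_convex_integral[OF assms(2) False, of "I x" "conc \<phi>"] J
        convex_integral_le[OF assms(1,2)]
      by (meson order_trans)
  qed
qed

theorem theorem4p7:
  fixes \<phi>l \<phi>u :: "('a::t3_space \<Rightarrow> ereal) \<Rightarrow> ereal"
    and H :: "('a \<Rightarrow> real) set"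
  assumes "monetary_risk_measure \<phi>l" and "monetary_risk_measure \<phi>u"
    and "\<And>f. f \<in> B_fun \<Longrightarrow> \<phi>l f \<le> \<phi>u f"
    and "weakly_maxitive \<phi>u"
    and "\<And>(N::nat) f g. \<lbrakk>N \<ge> 1; f \<in> U_fun; \<And>i. i \<in> {1..N} \<Longrightarrow> g i \<in> L_fun;
           \<And>x. f x \<le> (SUP i\<in>{1..N}. g i x)\<rbrakk>
         \<Longrightarrow> \<phi>l f \<le> max (\<phi>l (g 1)) (SUP i\<in>{2..N}. \<phi>u (g i))"
    and "H \<noteq> {}" and "\<And>f. f \<in> H \<Longrightarrow> continuous_on UNIV f"
    and "conc_tight (conc \<phi>u)"
  shows "(\<forall>x\<in>exposed_points H \<phi>l \<phi>u.
            I_min (conc \<phi>l) x = I_min (conc \<phi>u) x \<and> I_min (conc \<phi>u) x = conj_on H \<phi>u x)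
       \<and> (\<forall>C. closed C \<longrightarrow> conc \<phi>u C \<le> - (INF x\<in>C. conj_on H \<phi>u x))
       \<and> (\<forall>S. open S \<longrightarrow>
            - (INF x\<in>S \<inter> exposed_points H \<phi>l \<phi>u. conj_on H \<phi>u x) \<le> conc \<phi>l S)
       \<and> ((\<forall>S. open S \<longrightarrow> (INF x\<in>S. conj_on H \<phi>u x)
              = (INF x\<in>S \<inter> exposed_points H \<phi>l \<phi>u. conj_on H \<phi>u x))
          \<longrightarrow> LDP \<phi>l \<phi>u (conj_on H \<phi>u) \<and> laplace_principle \<phi>l \<phi>u (conj_on H \<phi>u))"
proof -
  let ?E = "exposed_points H \<phi>l \<phi>u"
  let ?I = "conj_on H \<phi>u"
  have conc_le: "conc \<phi>l A \<le> conc \<phi>u A" if "A \<in> sets borel" for A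
    unfolding conc_eq_cutoff using assms(3) cutoff_in_B_fun[OF that] by blast
  have point: "- ?I x \<le> conc \<phi>l S" if "x \<in> ?E" "open S" "x \<in> S" for x S
    using exposed_point_lower_bound[OF assms(1,2,4,5,7,8)] that by blast
  have i: "I_min (conc \<phi>l) x = I_min (conc \<phi>u) x \<and> I_min (conc \<phi>u) x = ?I x" if "x \<in> ?E" for x
  proof -
    have "?I x \<le> I_min (conc \<phi>u) x" by (rule conj_on_le_I_min[OF assms(2,7)])
    moreover have "I_min (conc \<phi>u) x \<le> I_min (conc \<phi>l) x" by (rule I_min_antimono[OF conc_le])
    moreover have "I_min (conc \<phi>l) x \<le> ?I x" by (rule I_min_le[OF point[OF that]])
    ultimately show ?thesis by auto
  qed
  have ii: "conc \<phi>u C \<le> - (INF x\<in>C. ?I x)" if "closed C" for C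
    by (rule closed_upper_bound[OF assms(2,4,8,7) that])
  have iii: "- (INF x\<in>S \<inter> ?E. ?I x) \<le> conc \<phi>l S" if "open S" for S
    unfolding ereal_uminus_le_reorder[of "Inf _"]
    by (rule INF_greatest) (use point that in \<open>auto simp: ereal_uminus_le_reorder\<close>)
  have iv: "LDP \<phi>l \<phi>u ?I \<and> laplace_principle \<phi>l \<phi>u ?I"
    if inf: "\<And>S. open S \<Longrightarrow> (INF x\<in>S. ?I x) = (INF x\<in>S \<inter> ?E. ?I x)"
  proof
    \<comment> \<open>At exposed points the conjugate agrees with a minimal rate function, hence it is nonnegative; the assumption
      on infima, applied to the whole space, extends this to all points.\<close>
    have nonneg: "0 \<le> ?I x" for x
    proof -
      have "0 \<le> (INF x\<in>UNIV \<inter> ?E. ?I x)"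
        using i I_min_nonneg[OF assms(2)] by (intro INF_greatest) (metis IntD2)
      also have "\<dots> = (INF x. ?I x)" using inf[of UNIV] by simp
      also have "\<dots> \<le> ?I x" by (rule INF_lower) simp
      finally show ?thesis .
    qed
    have lower: "- (INF x\<in>S. ?I x) \<le> conc \<phi>l S" if "open S" for S
      using iii[OF that] inf[OF that] by simp
    have "- (INF x\<in>interior A. ?I x) \<le> conc \<phi>l A" if "A \<in> sets borel" for A
      using lower[OF open_interior] conc_mono[OF assms(1) _ that interior_subset]
      by (meson borel_open open_interior order_trans)
    moreover have "conc \<phi>u A \<le> - (INF x\<in>closure A. ?I x)" if "A \<in> sets borel" for A
      using ii[OF closed_closure] conc_mono[OF assms(2) that _ closure_subset]
      by (meson borel_closed closed_closure order_trans)
    ultimately show "LDP \<phi>l \<phi>u ?I"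
      using conc_le nonneg by (simp add: LDP_def rate_function_def)
    have lower_point: "- ?I x \<le> conc \<phi>l S" if "open S" "x \<in> S" for x S
      using lower[OF that(1)] INF_lower[OF that(2), of ?I]
      by (meson ereal_minus_le_minus order_trans)
    have "\<phi>l f = \<phi>u f \<and> \<phi>u f = (SUP x. f x - ?I x)" if f: "f \<in> C_of \<phi>u" for f
    proof -
      have L: "f \<in> L_fun" using f by (auto simp: C_of_def C_fun_def)
      then have "f \<in> B_fun" using L_fun_subset_B_fun by blast
      then have "\<phi>l f \<le> \<phi>u f" by (rule assms(3))
      moreover have "\<phi>u f \<le> (SUP x. f x - ?I x)"
        by (rule laplace_upper_bound[OF assms(2,4,8,7) f])
      moreover have "(SUP x. f x - ?I x) \<le> \<phi>l f"
        by (rule laplace_lower_bound[OF assms(1) L nonneg lower_point])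
      ultimately show ?thesis by auto
    qed
    then show "laplace_principle \<phi>l \<phi>u ?I"
      using nonneg by (simp add: laplace_principle_def rate_function_def)
  qed
  show ?thesis using i ii iii iv by blast
qed

end
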